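(* Let $(\Omega,\mu)$ be a finite probability space, $r,\gamma>0$, $q\ge2$, and let $f\colon\Omega^n\to\mathbb{R}$ be $(r,\gamma)$-$L_2$-global. Let $0<\rho'\le1/3$, let $\rho=\rho'/\sqrt{2q}$, and suppose $\beta=\rho'\left(1+\frac{2(q-2)}{\log(1/\rho')}\right)$ satisfies $\beta\le\sqrt q\,(r/\sqrt2)^{-\frac{q-2}{q}}$. Then $\|T_\rho f\|_q^q\le\|f\|_2^2\gamma^{q-2}$.
   Context: Norms w.r.t. $\mu^n$; $\log$ natural. $T_\rho f(x)=\mathbb{E}_y f(y)$ where $y$ keeps each $x_i$ independently with probability $\rho$ and otherwise resamples it from $\mu$. For $i\in[n]$, $E_i$ averages over coordinate $i$ according to $\mu$, $L_i=I-E_i$, $L_S=\prod_{i\in S}L_i$, $D_{S,x}f=(L_Sf)_{S\to x}$ with $h_{S\to x}(y)=h(x,y)$. $f$ is $(r,\gamma)$-$L_2$-global if $\|D_{S,x}f\|_2\le r^{|S|}\gamma$ for all $S\subseteq[n]$ and $x\in\Omega^S$. *)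

theory Defs
  imports "HOL-Analysis.Analysis"
begin

text \<open>Finite probability space: a finite type 'a with weights mu (nonnegative, summing to 1).
  Points of Omega^n are functions nat => 'a in PiE {..<n} (extensional, undefined outside [n]).\<close>

definition prob_weights :: "('a::finite \<Rightarrow> real) \<Rightarrow> bool" where
  "prob_weights mu \<longleftrightarrow> (\<forall>a. 0 \<le> mu a) \<and> (\<Sum>a\<in>UNIV. mu a) = 1"

definition cube :: "nat set \<Rightarrow> (nat \<Rightarrow> 'a) set" where
  "cube I = PiE I (\<lambda>_. UNIV)"

definition expect_on :: "('a::finite \<Rightarrow> real) \<Rightarrow> nat set \<Rightarrow> ((nat \<Rightarrow> 'a) \<Rightarrow> real) \<Rightarrow> real" where
  "expect_on mu I g = (\<Sum>x\<in>cube I. (\<Prod>i\<in>I. mu (x i)) * g x)"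

definition lp_pow :: "('a::finite \<Rightarrow> real) \<Rightarrow> nat set \<Rightarrow> real \<Rightarrow> ((nat \<Rightarrow> 'a) \<Rightarrow> real) \<Rightarrow> real" where
  "lp_pow mu I p g = expect_on mu I (\<lambda>x. \<bar>g x\<bar> powr p)"

definition lp_norm :: "('a::finite \<Rightarrow> real) \<Rightarrow> nat set \<Rightarrow> real \<Rightarrow> ((nat \<Rightarrow> 'a) \<Rightarrow> real) \<Rightarrow> real" where
  "lp_norm mu I p g = lp_pow mu I p g powr (1 / p)"

text \<open>Noise operator: each coordinate kept w.p. rho, otherwise resampled from mu.\<close>
definition noise_op :: "('a::finite \<Rightarrow> real) \<Rightarrow> nat \<Rightarrow> real \<Rightarrow> ((nat \<Rightarrow> 'a) \<Rightarrow> real) \<Rightarrow> (nat \<Rightarrow> 'a) \<Rightarrow> real" where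
  "noise_op mu n rho f x =
     (\<Sum>y\<in>cube {..<n}. (\<Prod>i<n. rho * (if y i = x i then 1 else 0) + (1 - rho) * mu (y i)) * f y)"

definition E_op :: "('a::finite \<Rightarrow> real) \<Rightarrow> nat \<Rightarrow> ((nat \<Rightarrow> 'a) \<Rightarrow> real) \<Rightarrow> (nat \<Rightarrow> 'a) \<Rightarrow> real" where
  "E_op mu i f x = (\<Sum>a\<in>UNIV. mu a * f (x(i := a)))"

definition L_op :: "('a::finite \<Rightarrow> real) \<Rightarrow> nat \<Rightarrow> ((nat \<Rightarrow> 'a) \<Rightarrow> real) \<Rightarrow> (nat \<Rightarrow> 'a) \<Rightarrow> real" where
  "L_op mu i f x = f x - E_op mu i f x"

text \<open>L_S = product of L_i over i in S (the L_i commute; we compose in increasing order).\<close>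
definition L_set :: "('a::finite \<Rightarrow> real) \<Rightarrow> nat set \<Rightarrow> ((nat \<Rightarrow> 'a) \<Rightarrow> real) \<Rightarrow> (nat \<Rightarrow> 'a) \<Rightarrow> real" where
  "L_set mu S f = foldr (L_op mu) (sorted_list_of_set S) f"

definition merge :: "nat set \<Rightarrow> (nat \<Rightarrow> 'a) \<Rightarrow> (nat \<Rightarrow> 'a) \<Rightarrow> (nat \<Rightarrow> 'a)" where
  "merge S x y = (\<lambda>i. if i \<in> S then x i else y i)"

definition deriv_op :: "('a::finite \<Rightarrow> real) \<Rightarrow> nat set \<Rightarrow> (nat \<Rightarrow> 'a) \<Rightarrow> ((nat \<Rightarrow> 'a) \<Rightarrow> real) \<Rightarrow> (nat \<Rightarrow> 'a) \<Rightarrow> real" where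
  "deriv_op mu S x f = (\<lambda>y. L_set mu S f (merge S x y))"

definition L2_global :: "('a::finite \<Rightarrow> real) \<Rightarrow> nat \<Rightarrow> real \<Rightarrow> real \<Rightarrow> ((nat \<Rightarrow> 'a) \<Rightarrow> real) \<Rightarrow> bool" where
  "L2_global mu n r \<gamma> f \<longleftrightarrow>
     (\<forall>S \<subseteq> {..<n}. \<forall>x \<in> cube S.
        lp_norm mu ({..<n} - S) 2 (deriv_op mu S x f) \<le> r ^ card S * \<gamma>)"

end

(* The heart is a one-coordinate inequality for functions a + h with values in a Hilbert space, where
   a is the mean and E h = 0: with rho = rho'/sqrt(2q) and c = (beta/sqrt(2q))^q,
     E |a + rho h|^q <= (|a|^2 + E|h|^2 / 2)^(q/2) + c E |h|^q.
   It follows from a pointwise estimate of |1 + s|^q - 1 - q s: for s >= log(1/rho') / (2(q-2)) by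
   1 + s <= s beta/rho', otherwise by Taylor expansion. Since the first term on the right is again an
   L2-norm, the inequality tensorises: with N the noise operator of parameter 1/sqrt 2,
     |T_rho f|_q^q <= sum_S c^|S| E_x |N D_{S,x} f|_2^q.
   Globalness gives |N D_{S,x} f|_2^q <= (r^|S| gamma)^(q-2) |N D_{S,x} f|_2^2; the hypothesis on beta
   says c r^(q-2) <= 1/2, and sum_S 2^-|S| E_x |N D_{S,x} f|_2^2 = |f|_2^2 exactly, because
   (E_i g)^2 + E_i (L_i g)^2 / 2 + E_i (L_i g)^2 / 2 = E_i (g^2) in each coordinate. *)

theory Submission
  imports Defs
begin

section \<open>Convexity and Taylor bounds for real powers\<close>

lemma powr_convex_comb:
  fixes p l a b :: real
  assumes "1 \<le> p" "0 \<le> l" "l \<le> 1" "0 \<le> a" "0 \<le> b"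
  shows "(l * a + (1 - l) * b) powr p \<le> l * a powr p + (1 - l) * b powr p"
proof -
  have small: "(k * c) powr p \<le> k * c powr p" if "0 \<le> k" "k \<le> 1" "0 \<le> c" for k c :: real
  proof -
    have "k powr p \<le> k"
      using that assms(1) powr_mono'[of 1 p k] by (cases "k = 0") auto
    then show ?thesis using that by (simp add: powr_mult mult_right_mono)
  qed
  consider "a = 0" | "b = 0" | "a > 0" "b > 0" using assms by fastforce
  then show ?thesis
  proof cases
    case 3
    then show ?thesis
      using convex_onD[OF powr_convex[OF assms(1)], of "1 - l" a b] assms
      by (simp add: mult.commute)
  qed (use small[of l a] small[of "1 - l" b] assms in auto)
qed

text \<open>By the mean value theorem: the derivative \<open>p * z powr (p - 1)\<close> is at least
  \<open>p\<close> for \<open>z > 1\<close>. It later absorbs a linear term back into a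
  power.\<close>

lemma Bernoulli_powr:
  fixes p y :: real
  assumes "1 \<le> p" "0 \<le> y"
  shows "1 + p * y \<le> (1 + y) powr p"
proof (cases "y = 0")
  case False
  have "\<exists>z>1. z < 1 + y \<and> (1 + y) powr p - 1 powr p = (1 + y - 1) * (p * z powr (p - 1))"
    using assms False by (intro MVT2) (auto intro!: derivative_eq_intros)
  then obtain z where z: "z > 1" "(1 + y) powr p - 1 = y * (p * z powr (p - 1))" by auto
  have "1 \<le> z powr (p - 1)" using z assms by (simp add: ge_one_powr_ge_zero)
  then have "y * (p * 1) \<le> y * (p * z powr (p - 1))"
    using assms by (intro mult_left_mono) auto
  with z show ?thesis by (simp add: mult.commute)
qed simp

text \<open>Second-order expansion with Lagrange remainder. The intermediate point \<open>t\<close>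
  lies between 0 and \<open>s\<close>, and \<open>q - 2 \<ge> 0\<close>, so
  \<open>(1 + t) powr (q - 2)\<close> is at most its value at \<open>max 0 s\<close>.\<close>

lemma powr_Taylor:
  fixes q s :: real
  assumes "q \<ge> 2" "s > -1"
  shows "(1 + s) powr q \<le> 1 + q * s + q * (q - 1) / 2 * s\<^sup>2 * (1 + max 0 s) powr (q - 2)"
proof (cases "s = 0")
  case False
  define diff where "diff m t = (if m = 0 then (1 + t) powr q else if m = 1 then q * (1 + t) powr (q - 1)
     else q * (q - 1) * (1 + t) powr (q - 2))" for m :: nat and t :: real
  have d: "\<forall>m t. m < 2 \<and> min s 0 \<le> t \<and> t \<le> max s 0 \<longrightarrow> DERIV (diff m) t :> diff (Suc m) t"
  proof (intro allI impI)
    fix m :: nat and t assume "m < 2 \<and> min s 0 \<le> t \<and> t \<le> max s 0"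
    then have "m = 0 \<or> m = 1" "1 + t > 0" using assms by auto
    then show "DERIV (diff m) t :> diff (Suc m) t"
      unfolding diff_def by (auto intro!: derivative_eq_intros)
  qed
  have d0: "diff 0 = (\<lambda>s. (1 + s) powr q)" by (simp add: diff_def fun_eq_iff)
  obtain t where t: "if s < 0 then s < t \<and> t < 0 else 0 < t \<and> t < s"
    "(1 + s) powr q = (\<Sum>m<2. (diff m 0 / fact m) * (s - 0)^m) + (diff 2 t / fact 2) * (s - 0)^2"
    using Taylor[OF _ d0 d, of 0 s] False by auto
  have "(1 + t) powr (q - 2) \<le> (1 + max 0 s) powr (q - 2)"
    using t(1) assms by (intro powr_mono2) (auto split: if_splits)
  then have "q * (q - 1) / 2 * s\<^sup>2 * (1 + t) powr (q - 2) \<le> q * (q - 1) / 2 * s\<^sup>2 * (1 + max 0 s) powr (q - 2)"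
    using assms by (intro mult_left_mono) auto
  with t(2) show ?thesis by (simp add: diff_def numeral_2_eq_2 mult_ac)
qed simp

section \<open>Pointwise and averaged perturbation inequalities\<close>

text \<open>The linear term stays exact because it will average to zero. The quadratic term pays for
  the Taylor remainder at small \<open>s\<close>; the \<open>q\<close>-th power takes over where
  \<open>\<bar>s\<bar>\<close> is large.\<close>

lemma powr_perturbation:
  fixes q s \<rho>' :: real
  assumes q: "q \<ge> 2" and r: "0 < \<rho>'" "\<rho>' \<le> 1/3"
  shows "\<bar>1 + s\<bar> powr q \<le> 1 + q * s + q\<^sup>2 / (2 * \<rho>'\<^sup>2) * s\<^sup>2
     + (1 + 2 * (q - 2) / ln (1 / \<rho>')) powr q * \<bar>s\<bar> powr q"
proof -
  define L where "L = ln (1 / \<rho>')"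
  define C where "C = 1 + 2 * (q - 2) / L"
  have L: "L > 0" using r by (simp add: L_def)
  have C: "C \<ge> 1" using L q by (simp add: C_def)
  have r2: "1 / \<rho>'\<^sup>2 = exp (2 * L)"
    using r by (simp add: L_def exp_double power_divide)
  have "exp (2 * L) = (1 / \<rho>')\<^sup>2" using r2 by (simp add: power_divide)
  also have "\<dots> \<ge> 3\<^sup>2" using r by (intro power_mono) (auto simp: field_simps)
  finally have big: "exp (2 * L) \<ge> 9" by simp
  have Cs: "0 \<le> C powr q * \<bar>s\<bar> powr q" by simp
  have quad: "q * (q - 1) / 2 * s\<^sup>2 * m \<le> q\<^sup>2 / 2 * exp (2 * L) * s\<^sup>2" if "0 \<le> m" "m \<le> exp (2 * L)" for m
  proof -
    have "q * (q - 1) / 2 * s\<^sup>2 * m \<le> q\<^sup>2 / 2 * s\<^sup>2 * exp (2 * L)"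
      using that q by (intro mult_mono mult_right_mono divide_right_mono) (auto simp: power2_eq_square)
    then show ?thesis by (simp add: mult_ac)
  qed
  have "\<bar>1 + s\<bar> powr q \<le> 1 + q * s + q\<^sup>2 / 2 * exp (2 * L) * s\<^sup>2 + C powr q * \<bar>s\<bar> powr q"
  proof -
    \<comment> \<open>\<open>C\<close> is chosen so that \<open>1 + s \<le> C * s\<close> holds from
      \<open>L / (2 * (q - 2))\<close> on. Below this threshold
      \<open>(1 + s) powr (q - 2) \<le> exp (s * (q - 2))\<close> keeps the remainder under the
      quadratic term. At \<open>q = 2\<close> the threshold would divide by zero, but there the
      remainder factor is 1.\<close>
    consider "s \<le> -1" | "-1 < s" "s \<le> 0" | "0 < s" "s < L / (2 * (q - 2))" "q > 2" | "0 < s" "q = 2" | "s \<ge> L / (2 * (q - 2))" "q > 2" "s > 0"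
      using q by fastforce
    then show ?thesis
    proof cases
      case 1
      have "\<bar>1 + s\<bar> powr q \<le> \<bar>s\<bar> powr q" using 1 q by (intro powr_mono2) auto
      also have "\<dots> \<le> C powr q * \<bar>s\<bar> powr q" 
        using ge_one_powr_ge_zero[OF C, of q] q mult_right_mono[of 1 "C powr q" "\<bar>s\<bar> powr q"] by simp
      finally have a: "\<bar>1 + s\<bar> powr q \<le> C powr q * \<bar>s\<bar> powr q" .
      \<comment> \<open>The negative linear term has to be compensated:
        \<open>-s \<le> s\<^sup>2\<close>, \<open>q \<le> q\<^sup>2\<close>, and
        \<open>exp (2 * L) / 2 \<ge> 1\<close> because \<open>\<rho>' \<le> 1/3\<close>.\<close>
      have "q * (-s) \<le> q\<^sup>2 / 2 * exp (2 * L) * s\<^sup>2"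
      proof -
        have "-s \<le> s\<^sup>2" using 1 mult_left_mono[of 1 "-s" "-s"] by (simp add: power2_eq_square)
        moreover have "q \<le> q\<^sup>2" using q by (simp add: power2_eq_square)
        ultimately have "q * (-s) \<le> q\<^sup>2 * s\<^sup>2" using 1 q by (intro mult_mono) auto
        also have "\<dots> \<le> q\<^sup>2 * s\<^sup>2 * (exp (2 * L) / 2)" 
          using big mult_left_mono[of 1 "exp (2 * L) / 2" "q\<^sup>2 * s\<^sup>2"] by simp
        finally show ?thesis by (simp add: mult_ac)
      qed
      with a show ?thesis by simp
    next
      case 2
      then have "\<bar>1 + s\<bar> powr q \<le> 1 + q * s + q * (q - 1) / 2 * s\<^sup>2 * 1"
        using powr_Taylor[OF q, of s] by (cases "s = 0") (simp_all add: max_def)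
      moreover have "1 \<le> exp (2 * L)" using L by simp
      ultimately show ?thesis using quad[of 1] Cs by linarith
    next
      case 3
      have "(1 + s) powr (q - 2) \<le> exp s powr (q - 2)"
        using 3 q by (intro powr_mono2) auto
      also have "\<dots> = exp (s * (q - 2))" by (simp add: powr_def mult.commute)
      also have "\<dots> \<le> exp (2 * L)" 
        using 3 L by (simp add: field_simps)
      finally have "(1 + s) powr (q - 2) \<le> exp (2 * L)" .
      with quad[of "(1 + s) powr (q - 2)"] have "q * (q - 1) / 2 * s\<^sup>2 * (1 + s) powr (q - 2) \<le> q\<^sup>2 / 2 * exp (2 * L) * s\<^sup>2" by simp
      moreover have "(1 + s) powr q \<le> 1 + q * s + q * (q - 1) / 2 * s\<^sup>2 * (1 + s) powr (q - 2)"
        using powr_Taylor[OF q, of s] 3 by (simp add: max_def)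
      ultimately have "(1 + s) powr q \<le> 1 + q * s + q\<^sup>2 / 2 * exp (2 * L) * s\<^sup>2 + C powr q * \<bar>s\<bar> powr q"
        using Cs by linarith
      then show ?thesis using 3 by simp
    next
      case 4
      have "\<bar>1 + s\<bar> powr q \<le> 1 + q * s + q * (q - 1) / 2 * s\<^sup>2 * 1"
        using powr_Taylor[OF q, of s] 4 by simp
      moreover have "1 \<le> exp (2 * L)" using L by simp
      ultimately show ?thesis using quad[of 1] Cs by linarith
    next
      case 5
      then have "1 + s \<le> C * s" using L by (simp add: C_def field_simps)
      then have "(1 + s) powr q \<le> (C * s) powr q" using 5 q by (intro powr_mono2) auto
      also have "\<dots> = C powr q * \<bar>s\<bar> powr q" using C 5 by (simp add: powr_mult)
      finally have "\<bar>1 + s\<bar> powr q \<le> C powr q * \<bar>s\<bar> powr q" using 5 by simp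
      moreover have "0 \<le> 1 + q * s + q\<^sup>2 / 2 * exp (2 * L) * s\<^sup>2" using 5 by simp
      ultimately show ?thesis by simp
    qed
  qed
  moreover have "q\<^sup>2 / (2 * \<rho>'\<^sup>2) = q\<^sup>2 / 2 * exp (2 * L)"
    unfolding r2[symmetric] by simp
  ultimately show ?thesis by (simp only: C_def L_def)
qed

text \<open>Here \<open>u\<close> stands for the inner product of a unit vector with a vector \<open>h\<close> of squared norm \<open>b\<close>,
  and the left-hand side for the \<open>q\<close>-th power of the norm of their \<open>\<rho>\<close>-perturbation.\<close>

lemma powr_perturbation_Hilbert:
  fixes q \<rho>' u b :: real
  defines "\<rho> \<equiv> \<rho>' / sqrt (2 * q)"
  defines "c \<equiv> (\<rho> * (1 + 2 * (q - 2) / ln (1 / \<rho>'))) powr q"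
  assumes q: "q \<ge> 2" and r: "0 < \<rho>'" "\<rho>' \<le> 1/3" and b: "0 \<le> b" "u\<^sup>2 \<le> b"
  shows "(1 + 2 * \<rho> * u + \<rho>\<^sup>2 * b) powr (q / 2) \<le> 1 + q * \<rho> * u + q / 4 * b + c * b powr (q / 2)"
proof -
  define t where "t = sqrt b"
  have t: "t \<ge> 0" "b = t\<^sup>2" using b by (auto simp: t_def)
  have \<rho>: "\<rho> > 0" "\<rho>\<^sup>2 = \<rho>'\<^sup>2 / (2 * q)" using q r by (auto simp: \<rho>_def power_divide)
  have ut: "\<bar>u\<bar> \<le> t" using b t by (simp add: abs_le_square_iff[symmetric])
  have pw: "(x\<^sup>2) powr (q / 2) = \<bar>x\<bar> powr q" for x :: real
    by (subst power2_abs[symmetric]) (simp add: powr_powr del: power2_abs flip: powr_numeral)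
  define K where "K = 1 + 2 * (q - 2) / ln (1 / \<rho>')"
  have K: "K \<ge> 0" using q r by (auto simp: K_def intro!: add_nonneg_nonneg divide_nonneg_pos mult_nonneg_nonneg)
  have cK: "c = \<rho> powr q * K powr q"
    unfolding c_def K_def[symmetric] using K \<rho> by (simp add: powr_mult)
  have pt: "((1 + \<rho> * v)\<^sup>2) powr (q / 2) \<le> 1 + q * \<rho> * v + q / 4 * t\<^sup>2 + c * t powr q" if v: "\<bar>v\<bar> = t" for v
  proof -
    \<comment> \<open>The factor \<open>sqrt (2 * q)\<close> in \<open>\<rho>\<close> turns the
      quadratic coefficient into \<open>q / 4\<close>, half of the exponent \<open>q / 2\<close>;
      this half becomes the noise parameter \<open>1 / sqrt 2\<close>.\<close>
    have "q\<^sup>2 / (2 * \<rho>'\<^sup>2) * (\<rho> * v)\<^sup>2 = q / 4 * v\<^sup>2"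
      unfolding power_mult_distrib \<rho>(2) using q r by (simp add: power2_eq_square)
    moreover have "v\<^sup>2 = t\<^sup>2" using v by (metis power2_abs)
    moreover have "K powr q * \<bar>\<rho> * v\<bar> powr q = c * t powr q"
      using \<rho> t v by (simp add: cK abs_mult powr_mult)
    ultimately show ?thesis
      using powr_perturbation[OF q r, of "\<rho> * v"] by (simp only: pw K_def[symmetric] mult.assoc)
  qed
  \<comment> \<open>The left-hand side is convex in \<open>u\<close> and the right-hand side affine, so \<open>u = \<plusminus>t\<close> suffices.\<close>
  obtain l where l: "0 \<le> l" "l \<le> 1" "u = l * t + (1 - l) * (-t)"
  proof (cases "t = 0")
    case True then show ?thesis using ut that[of 0] by auto
  next
    case False
    with ut t show ?thesis by (intro that[of "(1 + u / t) / 2"]) (auto simp: field_simps abs_le_iff)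
  qed
  have "1 + 2 * \<rho> * u + \<rho>\<^sup>2 * b = l * (1 + \<rho> * t)\<^sup>2 + (1 - l) * (1 + \<rho> * (-t))\<^sup>2"
    unfolding l(3) t(2) by (simp add: power2_eq_square algebra_simps)
  then have "(1 + 2 * \<rho> * u + \<rho>\<^sup>2 * b) powr (q / 2)
     \<le> l * ((1 + \<rho> * t)\<^sup>2) powr (q / 2) + (1 - l) * ((1 + \<rho> * (-t))\<^sup>2) powr (q / 2)"
    using l q by (simp only:) (rule powr_convex_comb; simp)
  also have "\<dots> \<le> l * (1 + q * \<rho> * t + q / 4 * t\<^sup>2 + c * t powr q)
     + (1 - l) * (1 + q * \<rho> * (-t) + q / 4 * t\<^sup>2 + c * t powr q)"
    using l t by (intro add_mono mult_left_mono pt) auto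
  also have "\<dots> = 1 + q * \<rho> * u + q / 4 * t\<^sup>2 + c * t powr q"
    unfolding l(3) by (simp add: field_simps)
  finally show ?thesis using t pw[of t] by simp
qed

text \<open>In Hilbert-space terms \<open>\<alpha>\<close> is the squared norm of the mean,
  \<open>u a\<close> its inner product with the fluctuation at \<open>a\<close>, and
  \<open>b a\<close> the squared norm of that fluctuation. Dividing by \<open>\<alpha>\<close>
  normalises the mean, averaging kills the linear term, and Bernoulli's inequality restores the
  power.\<close>

lemma weighted_power_bound_one_coordinate:
  fixes mu u b :: "'a::finite \<Rightarrow> real" and q \<rho>' \<alpha> :: real
  defines "\<rho> \<equiv> \<rho>' / sqrt (2 * q)"
  defines "c \<equiv> (\<rho> * (1 + 2 * (q - 2) / ln (1 / \<rho>'))) powr q"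
  assumes mu: "prob_weights mu" and q: "q \<ge> 2" and r: "0 < \<rho>'" "\<rho>' \<le> 1/3" 
    and \<alpha>: "\<alpha> \<ge> 0" and b: "\<And>a. 0 \<le> b a" and u: "\<And>a. (u a)\<^sup>2 \<le> \<alpha> * b a" "(\<Sum>a\<in>UNIV. mu a * u a) = 0"
  shows "(\<Sum>a\<in>UNIV. mu a * (\<alpha> + 2 * \<rho> * u a + \<rho>\<^sup>2 * b a) powr (q / 2))
     \<le> (\<alpha> + (\<Sum>a\<in>UNIV. mu a * b a) / 2) powr (q / 2) + c * (\<Sum>a\<in>UNIV. mu a * b a powr (q / 2))"
proof -
  have mu0: "\<And>a. 0 \<le> mu a" and mu1: "(\<Sum>a\<in>UNIV. mu a) = 1"
    using mu by (auto simp: prob_weights_def)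
  define K where "K = 1 + 2 * (q - 2) / ln (1 / \<rho>')"
  have "2 * (q - 2) / ln (1 / \<rho>') \<ge> 0"
    using q r by (intro divide_nonneg_pos mult_nonneg_nonneg) auto
  then have K: "K \<ge> 1" by (simp add: K_def)
  have \<rho>: "\<rho> > 0" using q r by (simp add: \<rho>_def)
  show ?thesis
  proof (cases "\<alpha> = 0")
    \<comment> \<open>Without a mean there is nothing to normalise; the \<open>c\<close> term alone
      suffices, as \<open>K \<ge> 1\<close> gives \<open>\<rho> powr q \<le> c\<close>.\<close>
    case True
    with u have u0: "u a = 0" for a using u(1)[of a] by simp
    have "(\<rho>\<^sup>2 * b a) powr (q / 2) \<le> c * b a powr (q / 2)" for a
    proof -
      have "(\<rho>\<^sup>2) powr (q / 2) = \<rho> powr q" using \<rho> by (simp add: powr_powr flip: powr_numeral)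
      also have "\<dots> \<le> c" unfolding c_def K_def[symmetric]
        using \<rho> K q mult_left_mono[of 1 K \<rho>] by (intro powr_mono2) auto
      finally show ?thesis using b[of a] by (simp add: powr_mult mult_right_mono)
    qed
    then have "(\<Sum>a\<in>UNIV. mu a * (\<rho>\<^sup>2 * b a) powr (q / 2)) \<le> (\<Sum>a\<in>UNIV. mu a * (c * b a powr (q / 2)))"
      using mu0 by (intro sum_mono mult_left_mono) auto
    then show ?thesis using True u0 by (simp add: sum_distrib_left mult_ac add_increasing)
  next
    case False
    with \<alpha> have \<alpha>: "\<alpha> > 0" by simp
    define A where "A = \<alpha> powr (q / 2)"
    have A: "A > 0" using \<alpha> by (simp add: A_def)
    have scale: "(\<alpha> * x) powr (q / 2) = A * x powr (q / 2)" if "x \<ge> 0" for x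
      using that \<alpha> by (simp add: A_def powr_mult)
    define B where "B = (\<Sum>a\<in>UNIV. mu a * b a)"
    have B: "B \<ge> 0" unfolding B_def using mu0 b by (intro sum_nonneg) auto
    have pt: "(\<alpha> + 2 * \<rho> * u a + \<rho>\<^sup>2 * b a) powr (q / 2)
       \<le> A + A * q * \<rho> / \<alpha> * u a + A * q / (4 * \<alpha>) * b a + c * b a powr (q / 2)" for a
    proof -
      have hyp: "0 \<le> b a / \<alpha>" "(u a / \<alpha>)\<^sup>2 \<le> b a / \<alpha>"
        using \<alpha> b[of a] u(1)[of a] by (auto simp: power2_eq_square field_simps)
      \<comment> \<open>Completing the square: the base must be nonnegative for
        \<open>\<alpha>\<close> to be pulled out of the power.\<close>
      have "0 \<le> (1 + \<rho> * (u a / \<alpha>))\<^sup>2 + \<rho>\<^sup>2 * (b a / \<alpha> - (u a / \<alpha>)\<^sup>2)"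
        using hyp by simp
      also have "\<dots> = 1 + 2 * \<rho> * (u a / \<alpha>) + \<rho>\<^sup>2 * (b a / \<alpha>)"
        by (simp add: power2_eq_square algebra_simps)
      finally have nn: "0 \<le> 1 + 2 * \<rho> * (u a / \<alpha>) + \<rho>\<^sup>2 * (b a / \<alpha>)" .
      have "\<alpha> + 2 * \<rho> * u a + \<rho>\<^sup>2 * b a = \<alpha> * (1 + 2 * \<rho> * (u a / \<alpha>) + \<rho>\<^sup>2 * (b a / \<alpha>))"
        using \<alpha> by (simp add: field_simps)
      then have "(\<alpha> + 2 * \<rho> * u a + \<rho>\<^sup>2 * b a) powr (q / 2) 
        = A * (1 + 2 * \<rho> * (u a / \<alpha>) + \<rho>\<^sup>2 * (b a / \<alpha>)) powr (q / 2)"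
        by (simp only: scale[OF nn])
      also have "\<dots> \<le> A * (1 + q * \<rho> * (u a / \<alpha>) + q / 4 * (b a / \<alpha>) + c * (b a / \<alpha>) powr (q / 2))"
        unfolding \<rho>_def c_def
        using A by (intro mult_left_mono powr_perturbation_Hilbert q r hyp) auto
      also have "\<dots> = A + A * q * \<rho> / \<alpha> * u a + A * q / (4 * \<alpha>) * b a + c * (A * (b a / \<alpha>) powr (q / 2))"
        by (simp add: algebra_simps)
      also have "A * (b a / \<alpha>) powr (q / 2) = b a powr (q / 2)"
        using scale[OF hyp(1)] \<alpha> by simp
      finally show ?thesis .
    qed
    have "(\<Sum>a\<in>UNIV. mu a * (\<alpha> + 2 * \<rho> * u a + \<rho>\<^sup>2 * b a) powr (q / 2))
       \<le> (\<Sum>a\<in>UNIV. mu a * (A + A * q * \<rho> / \<alpha> * u a + A * q / (4 * \<alpha>) * b a + c * b a powr (q / 2)))"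
      by (intro sum_mono mult_left_mono pt mu0)
    also have "\<dots> = A * (\<Sum>a\<in>UNIV. mu a) + A * q * \<rho> / \<alpha> * (\<Sum>a\<in>UNIV. mu a * u a) 
        + A * q / (4 * \<alpha>) * B + c * (\<Sum>a\<in>UNIV. mu a * b a powr (q / 2))"
      unfolding B_def sum_distrib_left sum.distrib[symmetric]
      by (intro sum.cong refl) (simp add: algebra_simps)
    also have "\<dots> = A * (1 + (q / 2) * (B / (2 * \<alpha>))) + c * (\<Sum>a\<in>UNIV. mu a * b a powr (q / 2))"
      using mu1 u(2) by (simp add: algebra_simps)
    also have "A * (1 + (q / 2) * (B / (2 * \<alpha>))) \<le> A * (1 + B / (2 * \<alpha>)) powr (q / 2)"
      using A q B \<alpha> by (intro mult_left_mono Bernoulli_powr) auto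
    also have "\<dots> = (\<alpha> + B / 2) powr (q / 2)"
    proof -
      have "\<alpha> * (1 + B / (2 * \<alpha>)) = \<alpha> + B / 2" using \<alpha> by (simp add: field_simps)
      then show ?thesis using scale[of "1 + B / (2 * \<alpha>)"] B \<alpha> by simp
    qed
    finally show ?thesis by (simp add: B_def)
  qed
qed

section \<open>One-coordinate kernels and their tensor products\<close>

text \<open>The averages \<open>E\<^sub>i\<close>, the noise operators and the Laplacians \<open>L\<^sub>i\<close> are all one-coordinate
  kernel operators, so that commutation and tensorisation need to be proved only once.\<close>

definition kop :: "('a::finite \<Rightarrow> 'a \<Rightarrow> real) \<Rightarrow> nat \<Rightarrow> ((nat \<Rightarrow> 'a) \<Rightarrow> real) \<Rightarrow> (nat \<Rightarrow> 'a) \<Rightarrow> real" where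
  "kop K i g x = (\<Sum>b\<in>UNIV. K (x i) b * g (x(i := b)))"

text \<open>The tensor power of \<open>K\<close> on the coordinates in \<open>I\<close>, all others
  frozen at \<open>x\<close>. A single sum matches the shape of \<open>expect_on\<close> and
  \<open>noise_op\<close>; \<open>kset_insert\<close> recovers the composition of one-coordinate
  operators.\<close>

definition kset :: "('a::finite \<Rightarrow> 'a \<Rightarrow> real) \<Rightarrow> nat set \<Rightarrow> ((nat \<Rightarrow> 'a) \<Rightarrow> real) \<Rightarrow> (nat \<Rightarrow> 'a) \<Rightarrow> real" where
  "kset K I g x = (\<Sum>y\<in>cube I. (\<Prod>i\<in>I. K (x i) (y i)) * g (merge I y x))"

lemma cube_empty [simp]: "cube {} = {\<lambda>_. undefined}"
  by (simp add: cube_def)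

lemma kset_empty [simp]: "kset K {} g = g"
  by (rule ext) (simp add: kset_def merge_def)

text \<open>The two sums run over independent variables and can be exchanged, even for different
  kernels.\<close>

lemma kop_kset:
  fixes K K' :: "'a::finite \<Rightarrow> 'a \<Rightarrow> real"
  assumes "i \<notin> I"
  shows "kop K' i (kset K I g) = kset K I (kop K' i g)"
proof
  fix x :: "nat \<Rightarrow> 'a"
  have m: "merge I y (x(i := b)) = (merge I y x)(i := b)" for y b
    using assms by (auto simp: merge_def fun_eq_iff)
  have p: "(\<Prod>j\<in>I. K ((x(i := b)) j) (y j)) = (\<Prod>j\<in>I. K (x j) (y j))" for y b
    using assms by (intro prod.cong) auto
  have mi: "merge I y x i = x i" for y
    using assms by (simp add: merge_def)
  have "kop K' i (kset K I g) x =
    (\<Sum>b\<in>UNIV. \<Sum>y\<in>cube I. K' (x i) b * ((\<Prod>j\<in>I. K (x j) (y j)) * g ((merge I y x)(i := b))))"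
    unfolding kop_def kset_def p m by (simp add: sum_distrib_left)
  also have "\<dots> = (\<Sum>y\<in>cube I. \<Sum>b\<in>UNIV. K' (x i) b * ((\<Prod>j\<in>I. K (x j) (y j)) * g ((merge I y x)(i := b))))"
    by (rule sum.swap)
  also have "\<dots> = kset K I (kop K' i g) x"
    unfolding kop_def kset_def mi by (simp add: sum_distrib_left mult_ac)
  finally show "kop K' i (kset K I g) x = kset K I (kop K' i g) x" .
qed

text \<open>A point of the larger cube is a value at \<open>i\<close> together with a point of the
  smaller one. The inductions over coordinate sets run on this recursion.\<close>

lemma kset_insert:
  fixes K :: "'a::finite \<Rightarrow> 'a \<Rightarrow> real"
  assumes "finite I" "i \<notin> I"
  shows "kset K (insert i I) g = kop K i (kset K I g)"
proof
  fix x :: "nat \<Rightarrow> 'a"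
  have m: "merge (insert i I) (y(i := b)) x = (merge I y x)(i := b)" for y b
    by (auto simp: merge_def fun_eq_iff)
  have p: "(\<Prod>j\<in>I. K (x j) ((y(i := b)) j)) = (\<Prod>j\<in>I. K (x j) (y j))" for y b
    using assms by (intro prod.cong) auto
  have inj: "inj_on (\<lambda>(b, y). y(i := b)) (UNIV \<times> cube I)"
    using inj_combinator[OF assms(2), of "\<lambda>_. UNIV"] by (simp add: cube_def)
  have mi: "merge I y x i = x i" for y
    using assms by (simp add: merge_def)
  have "kset K (insert i I) g x = 
    (\<Sum>(b, y)\<in>UNIV \<times> cube I. (\<Prod>j\<in>insert i I. K (x j) ((y(i := b)) j)) * g ((merge I y x)(i := b)))"
    unfolding kset_def 
    unfolding cube_def PiE_insert_eq unfolding cube_def[symmetric]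
    by (subst sum.reindex[OF inj]) (simp add: case_prod_unfold m[symmetric])
  also have "\<dots> = (\<Sum>b\<in>UNIV. \<Sum>y\<in>cube I. (\<Prod>j\<in>insert i I. K (x j) ((y(i := b)) j)) * g ((merge I y x)(i := b)))"
    by (simp add: sum.cartesian_product)
  also have "\<dots> = (\<Sum>y\<in>cube I. \<Sum>b\<in>UNIV. (\<Prod>j\<in>insert i I. K (x j) ((y(i := b)) j)) * g ((merge I y x)(i := b)))"
    by (rule sum.swap)
  also have "\<dots> = kset K I (kop K i g) x"
    using assms by (simp add: kset_def kop_def p mi sum_distrib_left mult_ac del: fun_upd_apply) 
       (simp add: mult_ac)
  finally show "kset K (insert i I) g x = kop K i (kset K I g) x"
    by (simp add: kop_kset assms)
qed

definition avg_ker :: "('a \<Rightarrow> real) \<Rightarrow> 'a \<Rightarrow> 'a \<Rightarrow> real" where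
  "avg_ker mu a b = mu b"

definition noise_ker :: "('a \<Rightarrow> real) \<Rightarrow> real \<Rightarrow> 'a \<Rightarrow> 'a \<Rightarrow> real" where
  "noise_ker mu \<rho> a b = \<rho> * (if b = a then 1 else 0) + (1 - \<rho>) * mu b"

definition lap_ker :: "('a \<Rightarrow> real) \<Rightarrow> 'a \<Rightarrow> 'a \<Rightarrow> real" where
  "lap_ker mu a b = (if b = a then 1 else 0) - mu b"

abbreviation "avg mu \<equiv> kset (avg_ker mu)"

lemma kop_avg: "kop (avg_ker mu) i = E_op mu i"
  by (intro ext) (simp add: kop_def avg_ker_def E_op_def)

lemma kop_lap: "kop (lap_ker mu) i = L_op mu i"
  by (intro ext) (simp add: kop_def lap_ker_def L_op_def E_op_def left_diff_distrib sum_subtractf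
      if_distrib [of "\<lambda>c. c * _"] cong: if_cong)

text \<open>Resampling leaves only the average, so mixing it with the identity rescales just the
  fluctuation.\<close>

lemma kop_noise: "kop (noise_ker mu \<rho>) i g x = E_op mu i g x + \<rho> * L_op mu i g x"
proof -
  have "kop (noise_ker mu \<rho>) i g x = 
    (\<Sum>b\<in>UNIV. \<rho> * (if b = x i then g (x(i := b)) else 0)) + (\<Sum>b\<in>UNIV. (1 - \<rho>) * (mu b * g (x(i := b))))"
    unfolding kop_def noise_ker_def sum.distrib[symmetric] by (intro sum.cong refl) (simp add: algebra_simps)
  also have "\<dots> = \<rho> * g x + (1 - \<rho>) * E_op mu i g x"
    by (simp add: sum_distrib_left[symmetric] E_op_def)
  finally show ?thesis by (simp add: L_op_def algebra_simps)
qed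

lemma expect_on_eq_avg: "expect_on mu I (\<lambda>y. g (merge I y x)) = avg mu I g x"
  by (simp add: expect_on_def kset_def avg_ker_def)

lemma L_set_eq_kset:
  assumes "finite S" shows "L_set mu S f = kset (lap_ker mu) S f"
proof -
  have "foldr (L_op mu) xs f = kset (lap_ker mu) (set xs) f" if "distinct xs" for xs
    using that by (induction xs) (simp_all add: kset_insert kop_lap)
  from this[of "sorted_list_of_set S"] assms show ?thesis
    by (simp add: L_set_def)
qed

text \<open>For extensional \<open>x\<close>, overwriting all of \<open>{..<n}\<close> by
  \<open>y\<close> gives \<open>y\<close> itself, including the value \<open>undefined\<close>
  outside.\<close>

lemma noise_op_eq_kset:
  assumes "x \<in> cube {..<n}" shows "noise_op mu n \<rho> f x = kset (noise_ker mu \<rho>) {..<n} f x"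
proof -
  have "merge {..<n} y x = y" if "y \<in> cube {..<n}" for y
    using assms that by (auto simp: merge_def cube_def fun_eq_iff PiE_def extensional_def)
  then show ?thesis by (simp add: noise_op_def kset_def noise_ker_def)
qed

lemma avg_mono:
  assumes "\<And>a. 0 \<le> mu a" and "\<And>y. y \<in> cube I \<Longrightarrow> g (merge I y x) \<le> h (merge I y x)"
  shows "avg mu I g x \<le> avg mu I h x"
  unfolding kset_def avg_ker_def by (intro sum_mono mult_left_mono prod_nonneg assms) auto

lemma E_op_mono:
  assumes "\<And>a. 0 \<le> mu a" and "\<And>z. g z \<le> h z"
  shows "E_op mu i g x \<le> E_op mu i h x"
  unfolding E_op_def by (intro sum_mono mult_left_mono assms)

lemma kset_add: "kset K I (\<lambda>x. g x + h x) x = kset K I g x + kset K I h x"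
  by (simp add: kset_def ring_distribs sum.distrib)

lemma kset_cmult: "kset K I (\<lambda>x. c * g x) x = c * kset K I g x"
  by (simp add: kset_def sum_distrib_left mult_ac)

lemma kset_sum: "kset K I (\<lambda>x. \<Sum>s\<in>A. g s x) x = (\<Sum>s\<in>A. kset K I (g s) x)"
  unfolding kset_def sum_distrib_left by (rule sum.swap)

lemma kset_upd:
  assumes "i \<notin> I" shows "kset K I g (x(i := a)) = kset K I (\<lambda>w. g (w(i := a))) x"
proof -
  have "merge I y (x(i := a)) = (merge I y x)(i := a)" for y
    using assms by (auto simp: merge_def fun_eq_iff)
  moreover have "(\<Prod>j\<in>I. K ((x(i := a)) j) (y j)) = (\<Prod>j\<in>I. K (x j) (y j))" for y
    using assms by (intro prod.cong) auto
  ultimately show ?thesis unfolding kset_def by simp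
qed

lemma avg_nonneg:
  assumes "\<And>a. 0 \<le> mu a" and "\<And>z. 0 \<le> g z" shows "0 \<le> avg mu I g x"
  unfolding kset_def avg_ker_def by (intro sum_nonneg mult_nonneg_nonneg prod_nonneg assms)

lemma avg_Cauchy_Schwarz:
  assumes "\<And>a. 0 \<le> mu a"
  shows "(avg mu I (\<lambda>w. g w * h w) x)\<^sup>2 \<le> avg mu I (\<lambda>w. (g w)\<^sup>2) x * avg mu I (\<lambda>w. (h w)\<^sup>2) x"
proof -
  let ?w = "\<lambda>y. sqrt (\<Prod>i\<in>I. mu (y i))"
  have w: "(\<Prod>i\<in>I. mu (y i)) = ?w y * ?w y" for y
    using assms by (simp add: prod_nonneg)
  have *: "avg mu I (\<lambda>w. g w * h w) x = (\<Sum>y\<in>cube I. (?w y * g (merge I y x)) * (?w y * h (merge I y x)))"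
    for g h by (subst kset_def, subst avg_ker_def, subst w) (simp add: mult_ac)
  show ?thesis
    unfolding power2_eq_square[of "g _"] power2_eq_square[of "h _"] *
    by (simp only: power2_eq_square[symmetric] Cauchy_Schwarz_ineq_sum)
qed

lemma avg_insert:
  assumes "finite J" "i \<notin> J"
  shows "avg mu (insert i J) g = avg mu J (E_op mu i g)" "avg mu (insert i J) g = E_op mu i (avg mu J g)"
  using assms by (simp_all add: kset_insert kop_kset flip: kop_avg)

section \<open>Mean and fluctuation in one coordinate\<close>

lemma L_op_upd: "L_op mu i G (w(i := a)) = G (w(i := a)) - E_op mu i G w"
  by (simp add: L_op_def E_op_def)

lemma kop_noise_upd:
  "kop (noise_ker mu \<rho>) i G (w(i := a)) = E_op mu i G w + \<rho> * L_op mu i G (w(i := a))"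
  by (simp add: kop_noise) (simp add: E_op_def)

lemma sum_L_op:
  assumes "prob_weights mu" shows "(\<Sum>a\<in>UNIV. mu a * L_op mu i G (w(i := a))) = 0"
  using assms by (simp add: L_op_upd right_diff_distrib sum_subtractf prob_weights_def
      flip: sum_distrib_right) (simp add: E_op_def)

text \<open>Pythagoras: the mean is constant in coordinate \<open>i\<close> and the fluctuation
  averages to zero, so the cross term vanishes. Parameter 1 decomposes the second moment of
  \<open>G\<close>; parameter \<open>1 / sqrt 2\<close> halves the fluctuation part.\<close>

lemma E_op_noise_sq:
  assumes "prob_weights mu"
  shows "E_op mu i (\<lambda>w. (kop (noise_ker mu \<rho>) i G w)\<^sup>2) w
    = (E_op mu i G w)\<^sup>2 + \<rho>\<^sup>2 * E_op mu i (\<lambda>w. (L_op mu i G w)\<^sup>2) w"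
proof -
  have "E_op mu i (\<lambda>w. (kop (noise_ker mu \<rho>) i G w)\<^sup>2) w
     = (\<Sum>a\<in>UNIV. mu a * (E_op mu i G w + \<rho> * L_op mu i G (w(i := a)))\<^sup>2)"
    by (subst E_op_def) (simp only: kop_noise_upd)
  also have "\<dots> = (\<Sum>a\<in>UNIV. mu a) * (E_op mu i G w)\<^sup>2
     + 2 * \<rho> * E_op mu i G w * (\<Sum>a\<in>UNIV. mu a * L_op mu i G (w(i := a)))
     + \<rho>\<^sup>2 * (\<Sum>a\<in>UNIV. mu a * (L_op mu i G (w(i := a)))\<^sup>2)"
    unfolding sum_distrib_left sum_distrib_right sum.distrib[symmetric]
    by (intro sum.cong refl) (simp add: power2_eq_square algebra_simps)
  also have "\<dots> = (E_op mu i G w)\<^sup>2 + \<rho>\<^sup>2 * E_op mu i (\<lambda>w. (L_op mu i G w)\<^sup>2) w"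
    using assms by (simp add: sum_L_op prob_weights_def) (simp add: E_op_def)
  finally show ?thesis .
qed

text \<open>For fixed \<open>z\<close>, functions of the coordinates in \<open>J\<close> form the
  Hilbert space for the scalar inequality. The squared mean plus half the fluctuation is, by
  \<open>E_op_noise_sq\<close>, the squared norm after noise \<open>1 / sqrt 2\<close> with
  \<open>i\<close> averaged as well; thus \<open>i\<close> joins \<open>J\<close>.\<close>

lemma noise_one_coordinate:
  fixes mu :: "'a::finite \<Rightarrow> real" and q \<rho>' :: real
  defines "\<rho> \<equiv> \<rho>' / sqrt (2 * q)"
  defines "c \<equiv> (\<rho> * (1 + 2 * (q - 2) / ln (1 / \<rho>'))) powr q"
  assumes mu: "prob_weights mu" and q: "q \<ge> 2" and r: "0 < \<rho>'" "\<rho>' \<le> 1/3" 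
    and J: "finite J" "i \<notin> J"
  shows "E_op mu i (\<lambda>z. avg mu J (\<lambda>w. (kop (noise_ker mu \<rho>) i G w)\<^sup>2) z powr (q / 2)) z
   \<le> avg mu (insert i J) (\<lambda>w. (kop (noise_ker mu (1 / sqrt 2)) i G w)\<^sup>2) z powr (q / 2)
     + c * E_op mu i (\<lambda>z. avg mu J (\<lambda>w. (L_op mu i G w)\<^sup>2) z powr (q / 2)) z"
proof -
  have mu0: "\<And>a. 0 \<le> mu a" using mu by (auto simp: prob_weights_def)
  define A where "A = E_op mu i G"
  define h where "h a w = L_op mu i G (w(i := a))" for a w
  define \<alpha> where "\<alpha> = avg mu J (\<lambda>w. (A w)\<^sup>2) z"
  define u where "u a = avg mu J (\<lambda>w. A w * h a w) z" for a
  define b where "b a = avg mu J (\<lambda>w. (h a w)\<^sup>2) z" for a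
  have 1: "avg mu J (\<lambda>w. (kop (noise_ker mu \<rho>) i G w)\<^sup>2) (z(i := a)) = \<alpha> + 2 * \<rho> * u a + \<rho>\<^sup>2 * b a" for a
  proof -
    have "avg mu J (\<lambda>w. (kop (noise_ker mu \<rho>) i G w)\<^sup>2) (z(i := a))
      = avg mu J (\<lambda>w. (A w)\<^sup>2 + (2 * \<rho>) * (A w * h a w) + \<rho>\<^sup>2 * (h a w)\<^sup>2) z"
      by (simp only: kset_upd[OF J(2)] kop_noise_upd A_def[symmetric] h_def[symmetric])
        (simp add: power2_eq_square algebra_simps)
    then show ?thesis by (simp only: kset_add kset_cmult \<alpha>_def u_def b_def)
  qed
  have 2: "avg mu J (\<lambda>w. (L_op mu i G w)\<^sup>2) (z(i := a)) = b a" for a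
    by (simp only: kset_upd[OF J(2)] h_def[symmetric] b_def)
  have "(\<Sum>a\<in>UNIV. mu a * u a) = avg mu J (\<lambda>w. \<Sum>a\<in>UNIV. mu a * (A w * h a w)) z"
    by (simp only: kset_sum kset_cmult u_def)
  also have "(\<lambda>w. \<Sum>a\<in>UNIV. mu a * (A w * h a w)) = (\<lambda>w. A w * (\<Sum>a\<in>UNIV. mu a * h a w))"
    by (simp add: sum_distrib_left mult_ac)
  also have "\<dots> = (\<lambda>w. 0)" using sum_L_op[OF mu] by (simp add: h_def)
  finally have u0: "(\<Sum>a\<in>UNIV. mu a * u a) = 0" by (simp add: kset_def)
  have "avg mu (insert i J) (\<lambda>w. (kop (noise_ker mu (1 / sqrt 2)) i G w)\<^sup>2) z
     = avg mu J (\<lambda>w. (A w)\<^sup>2 + 1 / 2 * (\<Sum>a\<in>UNIV. mu a * (h a w)\<^sup>2)) z"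
    unfolding avg_insert(1)[OF J] E_op_noise_sq[OF mu]
    by (simp add: A_def h_def power_divide) (simp add: E_op_def)
  also have "\<dots> = \<alpha> + (\<Sum>a\<in>UNIV. mu a * b a) / 2"
    by (simp only: kset_add kset_cmult kset_sum \<alpha>_def b_def)
  finally have 3: "avg mu (insert i J) (\<lambda>w. (kop (noise_ker mu (1 / sqrt 2)) i G w)\<^sup>2) z
     = \<alpha> + (\<Sum>a\<in>UNIV. mu a * b a) / 2" .
  have "(\<Sum>a\<in>UNIV. mu a * (\<alpha> + 2 * \<rho> * u a + \<rho>\<^sup>2 * b a) powr (q / 2))
     \<le> (\<alpha> + (\<Sum>a\<in>UNIV. mu a * b a) / 2) powr (q / 2) + c * (\<Sum>a\<in>UNIV. mu a * b a powr (q / 2))"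
    unfolding \<rho>_def c_def
  proof (rule weighted_power_bound_one_coordinate[OF mu q r _ _ _ u0])
    show "0 \<le> \<alpha>" "\<And>a. 0 \<le> b a" unfolding \<alpha>_def b_def by (simp_all add: avg_nonneg mu0)
    show "(u a)\<^sup>2 \<le> \<alpha> * b a" for a
      unfolding \<alpha>_def b_def u_def by (rule avg_Cauchy_Schwarz[OF mu0])
  qed
  then show ?thesis
    unfolding 3 by (simp only: E_op_def[of mu i "\<lambda>z. _ z powr (q / 2)"] 1 2)
qed

section \<open>Tensorisation over all coordinates\<close>

lemma sum_Pow_insert:
  assumes "finite I" "i \<notin> I"
  shows "(\<Sum>S\<in>Pow (insert i I). F S) = (\<Sum>S\<in>Pow I. F S + F (insert i S))"
proof -
  have "inj_on (insert i) (Pow I)" using assms by (auto simp: inj_on_def)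
  then show ?thesis
    using assms unfolding Pow_insert sum.distrib
    by (subst sum.union_disjoint) (auto simp: sum.reindex)
qed

text \<open>The operator of \<open>i\<close> commutes to the innermost place, which leaves the
  expression for \<open>I\<close> applied to a new function, ready for an induction
  hypothesis.\<close>

lemma kset_diff_kset_insert:
  assumes "finite I" "i \<notin> I" "S \<subseteq> I"
  shows "kset T (insert i I - S) (kset L S g) = kset T (I - S) (kset L S (kop T i g))"
    and "kset T (insert i I - insert i S) (kset L (insert i S) g) = kset T (I - S) (kset L S (kop L i g))"
proof -
  have f: "finite S" "i \<notin> S" using assms finite_subset by auto
  have 1: "insert i I - S = insert i (I - S)" "insert i I - insert i S = I - S" using assms by auto
  show "kset T (insert i I - S) (kset L S g) = kset T (I - S) (kset L S (kop T i g))"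
    unfolding 1 using assms f by (simp add: kset_insert kop_kset)
  show "kset T (insert i I - insert i S) (kset L (insert i S) g) = kset T (I - S) (kset L S (kop L i g))"
    unfolding 1 using assms f by (simp add: kset_insert kop_kset)
qed

text \<open>The coordinates in \<open>J\<close> have already been moved inside the \<open>L\<^sub>2\<close>-norm; carrying them along makes the
  induction Hilbert-space-valued.\<close>

lemma noise_power_bound:
  fixes mu :: "'a::finite \<Rightarrow> real" and q \<rho>' :: real
  defines "\<rho> \<equiv> \<rho>' / sqrt (2 * q)"
  defines "c \<equiv> (\<rho> * (1 + 2 * (q - 2) / ln (1 / \<rho>'))) powr q"
  assumes mu: "prob_weights mu" and q: "q \<ge> 2" and r: "0 < \<rho>'" "\<rho>' \<le> 1/3" 
    and "finite I" "finite J" "I \<inter> J = {}"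
  shows "avg mu I (\<lambda>z. avg mu J (\<lambda>w. (kset (noise_ker mu \<rho>) I g w)\<^sup>2) z powr (q / 2)) x
   \<le> (\<Sum>S\<in>Pow I. c ^ card S * avg mu S (\<lambda>z. avg mu (J \<union> (I - S))
        (\<lambda>w. (kset (noise_ker mu (1 / sqrt 2)) (I - S) (kset (lap_ker mu) S g) w)\<^sup>2) z powr (q / 2)) x)"
  using assms(7-9)
proof (induction I arbitrary: J g x rule: finite_induct)
  case empty
  then show ?case by simp
next
  case (insert i I J g x)
  have mu0: "\<And>a. 0 \<le> mu a" using mu by (auto simp: prob_weights_def)
  have c: "c \<ge> 0" by (simp add: c_def)
  have iJ: "i \<notin> J" and d: "I \<inter> J = {}" "I \<inter> insert i J = {}" using insert by auto
  let ?T = "noise_ker mu \<rho>" and ?N = "noise_ker mu (1 / sqrt 2)" and ?L = "lap_ker mu"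
  let ?B = "\<lambda>I J g x S. avg mu S (\<lambda>z. avg mu (J \<union> (I - S))
        (\<lambda>w. (kset ?N (I - S) (kset ?L S g) w)\<^sup>2) z powr (q / 2)) x"
  let ?A = "\<lambda>I J g x. avg mu I (\<lambda>z. avg mu J (\<lambda>w. (kset ?T I g w)\<^sup>2) z powr (q / 2)) x"
  have "?A (insert i I) J g x 
    = avg mu I (E_op mu i (\<lambda>z. avg mu J (\<lambda>w. (kop ?T i (kset ?T I g) w)\<^sup>2) z powr (q / 2))) x"
    using insert by (simp add: avg_insert(1)) (simp add: kset_insert)
  also have "\<dots> \<le> avg mu I (\<lambda>z. avg mu (insert i J) (\<lambda>w. (kop ?N i (kset ?T I g) w)\<^sup>2) z powr (q / 2)
     + c * E_op mu i (\<lambda>z. avg mu J (\<lambda>w. (L_op mu i (kset ?T I g) w)\<^sup>2) z powr (q / 2)) z) x"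
    unfolding \<rho>_def c_def
    by (intro avg_mono mu0 noise_one_coordinate mu q r insert.prems iJ)
  \<comment> \<open>Moving the operators of \<open>i\<close> inward exposes two instances for
    \<open>I\<close>: \<open>kop ?N i g\<close> with \<open>i\<close> added to \<open>J\<close>,
    which yields the sets avoiding \<open>i\<close>, and \<open>kop ?L i g\<close> with
    \<open>J\<close> unchanged, which yields the sets containing \<open>i\<close> and one more
    factor \<open>c\<close>.\<close>
  also have "\<dots> = ?A I (insert i J) (kop ?N i g) x + c * E_op mu i (?A I J (kop ?L i g)) x"
    unfolding kset_add kset_cmult kop_lap[symmetric] kop_avg[symmetric]
    using insert.hyps by (simp add: kop_kset)
  also have "\<dots> \<le> (\<Sum>S\<in>Pow I. c ^ card S * ?B I (insert i J) (kop ?N i g) x S)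
     + c * E_op mu i (\<lambda>x. \<Sum>S\<in>Pow I. c ^ card S * ?B I J (kop ?L i g) x S) x"
    using insert.prems d
    by (intro add_mono insert.IH mult_left_mono E_op_mono mu0 c) auto
  also have "E_op mu i (\<lambda>x. \<Sum>S\<in>Pow I. c ^ card S * ?B I J (kop ?L i g) x S) x
     = (\<Sum>S\<in>Pow I. c ^ card S * E_op mu i (\<lambda>x. ?B I J (kop ?L i g) x S) x)"
    unfolding E_op_def sum_distrib_left by (subst sum.swap) (simp add: mult_ac)
  also have "(\<Sum>S\<in>Pow I. c ^ card S * ?B I (insert i J) (kop ?N i g) x S) + c * \<dots>
     = (\<Sum>S\<in>Pow (insert i I). c ^ card S * ?B (insert i I) J g x S)"
    unfolding sum_Pow_insert[OF insert.hyps] sum_distrib_left sum.distrib[symmetric]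
  proof (intro sum.cong refl arg_cong2[where f = "(+)"])
    fix S assume "S \<in> Pow I"
    then have S: "S \<subseteq> I" "finite S" "i \<notin> S" using insert.hyps finite_subset by auto
    have 1: "insert i J \<union> (I - S) = J \<union> (insert i I - S)" "J \<union> (insert i I - insert i S) = J \<union> (I - S)"
      using S insert.hyps by auto
    show "c ^ card S * ?B I (insert i J) (kop ?N i g) x S = c ^ card S * ?B (insert i I) J g x S"
      unfolding 1 kset_diff_kset_insert(1)[OF insert.hyps S(1)] ..
    show "c * (c ^ card S * E_op mu i (\<lambda>x. ?B I J (kop ?L i g) x S) x)
       = c ^ card (insert i S) * ?B (insert i I) J g x (insert i S)"
      unfolding 1 kset_diff_kset_insert(2)[OF insert.hyps S(1)]
      using S by (simp add: avg_insert(2))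
  qed
  finally show ?case .
qed

section \<open>The exact energy identity and the bounds from globalness\<close>

text \<open>In each coordinate, noise \<open>1 / sqrt 2\<close> retains half the fluctuation energy
  and the weight 1/2 on the Laplacian term returns the other half, so the induction loses
  nothing.\<close>

lemma sum_Pow_noise_sq:
  fixes mu :: "'a::finite \<Rightarrow> real"
  assumes mu: "prob_weights mu" and "finite I"
  shows "(\<Sum>S\<in>Pow I. (1/2) ^ card S * avg mu I
    (\<lambda>w. (kset (noise_ker mu (1 / sqrt 2)) (I - S) (kset (lap_ker mu) S g) w)\<^sup>2) x) = avg mu I (\<lambda>w. (g w)\<^sup>2) x"
  using assms(2)
proof (induction I arbitrary: g x rule: finite_induct)
  case (insert i I g x)
  let ?N = "noise_ker mu (1 / sqrt 2)" and ?L = "lap_ker mu"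
  let ?B = "\<lambda>I g S. (\<lambda>w. (kset ?N (I - S) (kset ?L S g) w)\<^sup>2)"
  have "(\<Sum>S\<in>Pow (insert i I). (1/2) ^ card S * avg mu (insert i I) (?B (insert i I) g S) x)
    = (\<Sum>S\<in>Pow I. (1/2) ^ card S * E_op mu i (avg mu I (?B I (kop ?N i g) S)) x
        + 1/2 * ((1/2) ^ card S * E_op mu i (avg mu I (?B I (kop ?L i g) S)) x))"
    unfolding sum_Pow_insert[OF insert.hyps]
  proof (intro sum.cong refl arg_cong2[where f = "(+)"])
    fix S assume "S \<in> Pow I"
    then have S: "S \<subseteq> I" "finite S" "i \<notin> S" using insert.hyps finite_subset by auto
    show "(1/2) ^ card S * avg mu (insert i I) (?B (insert i I) g S) x
       = (1/2) ^ card S * E_op mu i (avg mu I (?B I (kop ?N i g) S)) x"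
      unfolding kset_diff_kset_insert(1)[OF insert.hyps S(1)] avg_insert(2)[OF insert.hyps] ..
    show "(1/2) ^ card (insert i S) * avg mu (insert i I) (?B (insert i I) g (insert i S)) x
       = 1/2 * ((1/2) ^ card S * E_op mu i (avg mu I (?B I (kop ?L i g) S)) x)"
      unfolding kset_diff_kset_insert(2)[OF insert.hyps S(1)] avg_insert(2)[OF insert.hyps] using S by simp
  qed
  also have "\<dots> = E_op mu i (\<lambda>x. \<Sum>S\<in>Pow I. (1/2) ^ card S * avg mu I (?B I (kop ?N i g) S) x) x
     + 1/2 * E_op mu i (\<lambda>x. \<Sum>S\<in>Pow I. (1/2) ^ card S * avg mu I (?B I (kop ?L i g) S) x) x"
    unfolding E_op_def sum_distrib_left sum.distrib
    by (subst (3 4) sum.swap) (simp add: mult_ac)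
  also have "\<dots> = E_op mu i (avg mu I (\<lambda>w. (kop ?N i g w)\<^sup>2)) x + 1/2 * E_op mu i (avg mu I (\<lambda>w. (kop ?L i g w)\<^sup>2)) x"
    by (simp only: insert.IH)
  also have "\<dots> = avg mu I (\<lambda>x. E_op mu i (\<lambda>w. (kop ?N i g w)\<^sup>2) x + 1/2 * E_op mu i (\<lambda>w. (kop ?L i g w)\<^sup>2) x) x"
    unfolding kset_add kset_cmult using insert.hyps by (simp add: kop_kset flip: kop_avg)
  also have "(\<lambda>x. E_op mu i (\<lambda>w. (kop ?N i g w)\<^sup>2) x + 1/2 * E_op mu i (\<lambda>w. (kop ?L i g w)\<^sup>2) x) 
    = E_op mu i (\<lambda>w. (g w)\<^sup>2)"
  proof
    fix w
    have "kop (noise_ker mu 1) i g = g" by (rule ext) (simp add: kop_noise L_op_def)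
    with E_op_noise_sq[OF mu, of i 1 g w]
    have "E_op mu i (\<lambda>w. (g w)\<^sup>2) w = (E_op mu i g w)\<^sup>2 + E_op mu i (\<lambda>w. (L_op mu i g w)\<^sup>2) w" by simp
    then show "E_op mu i (\<lambda>w. (kop ?N i g w)\<^sup>2) w + 1/2 * E_op mu i (\<lambda>w. (kop ?L i g w)\<^sup>2) w = E_op mu i (\<lambda>w. (g w)\<^sup>2) w"
      by (simp add: E_op_noise_sq[OF mu] kop_lap power_divide)
  qed
  finally show ?case by (simp only: avg_insert(1)[OF insert.hyps])
qed simp

text \<open>The left-hand side is the term \<open>S = {}\<close> of the preceding identity, whose
  terms are all nonnegative.\<close>

lemma noise_contraction:
  fixes mu :: "'a::finite \<Rightarrow> real"
  assumes mu: "prob_weights mu" and I: "finite I"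
  shows "avg mu I (\<lambda>w. (kset (noise_ker mu (1 / sqrt 2)) I g w)\<^sup>2) x \<le> avg mu I (\<lambda>w. (g w)\<^sup>2) x"
proof -
  have mu0: "\<And>a. 0 \<le> mu a" using mu by (auto simp: prob_weights_def)
  show ?thesis
    unfolding sum_Pow_noise_sq[OF mu I, of g x, symmetric]
    using member_le_sum[of "{}" "Pow I" "\<lambda>S. (1/2) ^ card S * avg mu I
      (\<lambda>w. (kset (noise_ker mu (1 / sqrt 2)) (I - S) (kset (lap_ker mu) S g) w)\<^sup>2) x"] I
    by (simp add: avg_nonneg mu0)
qed

lemma avg_avg:
  assumes "finite I" "S \<subseteq> I"
  shows "avg mu S (avg mu (I - S) g) = avg mu I g"
proof -
  have "finite S" using assms finite_subset by blast
  from this assms(2) show ?thesis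
  proof (induction S rule: finite_induct)
    case (insert i S)
    have "finite (I - insert i S)" "i \<notin> I - insert i S" using assms by auto
    moreover have "insert i (I - insert i S) = I - S" using insert by auto
    ultimately have "avg mu (I - S) g = E_op mu i (avg mu (I - insert i S) g)"
      using avg_insert(2)[of "I - insert i S" i mu g] by simp
    with insert show ?case by (simp add: avg_insert(1))
  qed simp
qed

lemma L2_global_avg:
  assumes mu: "prob_weights mu" and gl: "L2_global mu n r \<gamma> f" and S: "S \<subseteq> {..<n}" "z \<in> cube S"
    and pos: "r > 0" "\<gamma> > 0"
  shows "avg mu ({..<n} - S) (\<lambda>w. (kset (lap_ker mu) S f w)\<^sup>2) z \<le> (r ^ card S * \<gamma>)\<^sup>2"
proof -
  have mu0: "\<And>a. 0 \<le> mu a" using mu by (auto simp: prob_weights_def)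
  let ?V = "{..<n} - S"
  have f: "finite S" using S finite_subset by blast
  \<comment> \<open>Both sides agree on \<open>S\<close> and on \<open>?V\<close> and are
    \<open>undefined\<close> elsewhere; this reconciles the merging order of \<open>deriv_op\<close>
    with that of \<open>kset\<close>.\<close>
  have m: "merge S z y = merge ?V y z" if "y \<in> cube ?V" for y
    using that S by (auto simp: merge_def cube_def fun_eq_iff PiE_def extensional_def)
  have "lp_pow mu ?V 2 (deriv_op mu S z f) = avg mu ?V (\<lambda>w. (kset (lap_ker mu) S f w)\<^sup>2) z"
    unfolding lp_pow_def deriv_op_def L_set_eq_kset[OF f] expect_on_eq_avg[symmetric]
    unfolding expect_on_def by (intro sum.cong refl) (simp add: m)
  then have "avg mu ?V (\<lambda>w. (kset (lap_ker mu) S f w)\<^sup>2) z powr (1 / 2) \<le> r ^ card S * \<gamma>"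
    using gl S unfolding L2_global_def lp_norm_def by metis
  then have "sqrt (avg mu ?V (\<lambda>w. (kset (lap_ker mu) S f w)\<^sup>2) z) \<le> r ^ card S * \<gamma>"
    using avg_nonneg[of mu, OF mu0] by (subst (asm) powr_half_sqrt) auto
  then show ?thesis by (rule sqrt_le_D)
qed

text \<open>\<open>M\<close> plays a squared L2 norm. One factor \<open>M\<close> is kept, to be
  summed exactly later; the remaining power \<open>(q - 2) / 2\<close> is bounded through
  \<open>R\<close>.\<close>

lemma powr_half_le_interpolate:
  fixes M R q :: real
  assumes "0 \<le> M" "M \<le> R\<^sup>2" "R > 0" "q \<ge> 2"
  shows "M powr (q / 2) \<le> R powr (q - 2) * M"
proof (cases "M = 0")
  case False
  then have "M powr (q / 2) = M powr ((q - 2) / 2) * M powr 1"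
    unfolding powr_add[symmetric] by (simp add: field_simps)
  also have "M powr ((q - 2) / 2) \<le> (R\<^sup>2) powr ((q - 2) / 2)"
    using assms by (intro powr_mono2) auto
  also have "(R\<^sup>2) powr ((q - 2) / 2) = R powr (q - 2)"
  proof -
    have "R\<^sup>2 = R powr 2" using assms by simp
    moreover have "2 * ((q - 2) / 2) = q - 2" by simp
    ultimately show ?thesis by (simp only: powr_powr)
  qed
  finally show ?thesis using assms False by simp
qed simp

text \<open>Dividing the bound on \<beta> by \<open>sqrt (2 * q)\<close> leaves a factor
  \<open>1 / sqrt 2\<close>, and the \<open>q\<close>-th power clears the denominator of the
  exponent. The powers of \<open>r\<close> cancel, and
  \<open>sqrt 2 powr (q - 2) / sqrt 2 powr q\<close> is 1/2.\<close>

lemma noise_constant_le_half: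
  fixes q r \<rho>' :: real
  assumes q: "q \<ge> 2" and r: "r > 0" and \<rho>': "0 < \<rho>'" "\<rho>' \<le> 1/3"
    and \<beta>: "\<rho>' * (1 + 2 * (q - 2) / ln (1 / \<rho>')) \<le> sqrt q * (r / sqrt 2) powr (- (q - 2) / q)"
  shows "(\<rho>' / sqrt (2 * q) * (1 + 2 * (q - 2) / ln (1 / \<rho>'))) powr q * r powr (q - 2) \<le> 1/2"
proof -
  have "2 * (q - 2) / ln (1 / \<rho>') \<ge> 0"
    using q \<rho>' by (intro divide_nonneg_pos mult_nonneg_nonneg) auto
  then have nn: "0 \<le> \<rho>' / sqrt (2 * q) * (1 + 2 * (q - 2) / ln (1 / \<rho>'))" using \<rho>' q by simp
  have "\<rho>' / sqrt (2 * q) * (1 + 2 * (q - 2) / ln (1 / \<rho>')) 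
    = \<rho>' * (1 + 2 * (q - 2) / ln (1 / \<rho>')) / sqrt (2 * q)" by simp
  also have "\<dots> \<le> sqrt q * (r / sqrt 2) powr (- (q - 2) / q) / sqrt (2 * q)"
    using \<beta> q by (intro divide_right_mono) auto
  also have "\<dots> = (r / sqrt 2) powr (- (q - 2) / q) / sqrt 2"
    using q by (simp add: real_sqrt_mult)
  finally have "(\<rho>' / sqrt (2 * q) * (1 + 2 * (q - 2) / ln (1 / \<rho>'))) powr q
     \<le> ((r / sqrt 2) powr (- (q - 2) / q) / sqrt 2) powr q"
    using q nn by (intro powr_mono2) auto
  also have "\<dots> = (r / sqrt 2) powr (- (q - 2)) / sqrt 2 powr q"
  proof -
    have "((r / sqrt 2) powr (- (q - 2) / q)) powr q = (r / sqrt 2) powr (- (q - 2))"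
      unfolding powr_powr using q by simp
    moreover have "((r / sqrt 2) powr (- (q - 2) / q) / sqrt 2) powr q 
      = ((r / sqrt 2) powr (- (q - 2) / q)) powr q / sqrt 2 powr q"
      by (rule powr_divide)
    ultimately show ?thesis by simp
  qed
  also have "\<dots> = sqrt 2 powr (q - 2) / (r powr (q - 2) * sqrt 2 powr q)"
    using r by (simp only: powr_minus powr_divide) (simp add: powr_divide field_simps)
  also have "sqrt 2 powr q = sqrt 2 powr (q - 2) * 2"
  proof -
    have "sqrt 2 powr q = sqrt 2 powr (q - 2) * sqrt 2 powr 2"
      by (simp only: powr_add[symmetric]) simp
    moreover have "sqrt 2 powr 2 = 2" by simp
    ultimately show ?thesis by (simp only:)
  qed
  finally have "(\<rho>' / sqrt (2 * q) * (1 + 2 * (q - 2) / ln (1 / \<rho>'))) powr q \<le> 1 / (2 * r powr (q - 2))"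
    by (simp add: field_simps)
  then show ?thesis using r by (simp add: field_simps)
qed

section \<open>The hypercontractive estimate for global functions\<close>

theorem mainTheorem9:
  fixes mu :: "'a::finite \<Rightarrow> real" and n :: nat and r \<gamma> q \<rho>' :: real
    and f :: "(nat \<Rightarrow> 'a) \<Rightarrow> real"
  assumes "prob_weights mu"
    and "r > 0" and "\<gamma> > 0" and "q \<ge> 2"
    and "L2_global mu n r \<gamma> f"
    and "0 < \<rho>'" and "\<rho>' \<le> 1/3"
    and "\<rho>'* (1 + 2 * (q - 2) / ln (1 / \<rho>')) \<le> sqrt q * (r / sqrt 2) powr (- (q - 2) / q)"
  shows "lp_pow mu {..<n} q (noise_op mu n (\<rho>' / sqrt (2 * q)) f)
           \<le> lp_pow mu {..<n} 2 f * \<gamma> powr (q - 2)"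
proof -
  note mu = assms(1) and pos = assms(2,3) and q = assms(4) and r = assms(6,7)
  have mu0: "\<And>a. 0 \<le> mu a" using mu by (auto simp: prob_weights_def)
  \<comment> \<open>\<open>?o\<close> is the base point for \<open>avg\<close>: being
    \<open>undefined\<close> everywhere, it makes merging with an extensional point return that
    point.\<close>
  let ?I = "{..<n}" and ?o = "\<lambda>_::nat. undefined :: 'a"
  let ?N = "noise_ker mu (1 / sqrt 2)"
  define \<rho> where "\<rho> = \<rho>' / sqrt (2 * q)"
  define c where "c = (\<rho> * (1 + 2 * (q - 2) / ln (1 / \<rho>'))) powr q"
  have c: "c \<ge> 0" by (simp add: c_def)
  have half: "c * r powr (q - 2) \<le> 1/2"
    unfolding c_def \<rho>_def by (rule noise_constant_le_half[OF q pos(1) r assms(8)])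
  have m: "merge S y ?o = y" if "y \<in> cube S" for y S
    using that by (auto simp: merge_def cube_def fun_eq_iff PiE_def extensional_def)
  have pw: "\<bar>t\<bar> powr q = (t\<^sup>2) powr (q / 2)" for t :: real
    by (subst power2_abs[symmetric]) (simp add: powr_powr del: power2_abs flip: powr_numeral)
  have ex: "expect_on mu ?I g = avg mu ?I g ?o" for g
    unfolding expect_on_eq_avg[symmetric] unfolding expect_on_def by (simp add: m)
  let ?F = "\<lambda>S w. (kset ?N (?I - S) (kset (lap_ker mu) S f) w)\<^sup>2"
  have "lp_pow mu ?I q (noise_op mu n \<rho> f) = avg mu ?I (\<lambda>z. \<bar>kset (noise_ker mu \<rho>) ?I f z\<bar> powr q) ?o"
    unfolding lp_pow_def ex[symmetric] unfolding expect_on_def by (simp add: noise_op_eq_kset)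
  also have "\<dots> = avg mu ?I (\<lambda>z. avg mu {} (\<lambda>w. (kset (noise_ker mu \<rho>) ?I f w)\<^sup>2) z powr (q / 2)) ?o"
    by (simp add: pw)
  also have "\<dots> \<le> (\<Sum>S\<in>Pow ?I. c ^ card S * avg mu S (\<lambda>z. avg mu ({} \<union> (?I - S)) (?F S) z powr (q / 2)) ?o)"
    unfolding \<rho>_def c_def by (intro noise_power_bound mu q r) auto
  also have "\<dots> \<le> (\<Sum>S\<in>Pow ?I. (1/2) ^ card S * avg mu ?I (?F S) ?o * \<gamma> powr (q - 2))"
  proof (rule sum_mono)
    fix S assume "S \<in> Pow ?I"
    then have S: "S \<subseteq> ?I" by simp
    have "avg mu S (\<lambda>z. avg mu (?I - S) (?F S) z powr (q / 2)) ?o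
      \<le> avg mu S (\<lambda>z. (r ^ card S * \<gamma>) powr (q - 2) * avg mu (?I - S) (?F S) z) ?o"
    proof (rule avg_mono[OF mu0])
      fix z :: "nat \<Rightarrow> 'a" assume z: "z \<in> cube S"
      \<comment> \<open>For fixed \<open>z\<close>, contraction removes the noise on the complement
        of \<open>S\<close>, and globalness bounds the derivative that is left.\<close>
      have "avg mu (?I - S) (?F S) z \<le> (r ^ card S * \<gamma>)\<^sup>2"
        using noise_contraction[OF mu, of "?I - S"] L2_global_avg[OF mu assms(5) S z pos] 
        by (meson finite_Diff finite_lessThan order_trans)
      then show "avg mu (?I - S) (?F S) (merge S z ?o) powr (q / 2)
          \<le> (r ^ card S * \<gamma>) powr (q - 2) * avg mu (?I - S) (?F S) (merge S z ?o)"
        unfolding m[OF z] using pos q by (intro powr_half_le_interpolate avg_nonneg mu0) auto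
    qed
    also have "\<dots> = (r ^ card S * \<gamma>) powr (q - 2) * avg mu ?I (?F S) ?o"
      unfolding kset_cmult avg_avg[OF finite_lessThan S] ..
    also have "(r ^ card S * \<gamma>) powr (q - 2) = (r powr (q - 2)) ^ card S * \<gamma> powr (q - 2)"
    proof -
      have "(r ^ card S) powr (q - 2) = (r powr (q - 2)) ^ card S"
        using pos by (simp add: powr_powr powr_power mult.commute flip: powr_realpow)
      then show ?thesis using pos by (simp add: powr_mult)
    qed
    finally have "c ^ card S * avg mu S (\<lambda>z. avg mu (?I - S) (?F S) z powr (q / 2)) ?o
      \<le> c ^ card S * ((r powr (q - 2)) ^ card S * \<gamma> powr (q - 2) * avg mu ?I (?F S) ?o)"
      using c by (intro mult_left_mono) auto
    \<comment> \<open>Gathering \<open>c\<close> with \<open>r powr (q - 2)\<close> gives one factor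
      of at most 1/2 per element of \<open>S\<close>, exactly the weights of the energy
      identity.\<close>
    also have "\<dots> = (c * r powr (q - 2)) ^ card S * (avg mu ?I (?F S) ?o * \<gamma> powr (q - 2))"
      by (simp add: power_mult_distrib)
    also have "\<dots> \<le> (1/2) ^ card S * (avg mu ?I (?F S) ?o * \<gamma> powr (q - 2))"
      using half c by (intro mult_right_mono power_mono mult_nonneg_nonneg avg_nonneg mu0) auto
    finally show "c ^ card S * avg mu S (\<lambda>z. avg mu ({} \<union> (?I - S)) (?F S) z powr (q / 2)) ?o
      \<le> (1/2) ^ card S * avg mu ?I (?F S) ?o * \<gamma> powr (q - 2)" by simp
  qed
  also have "\<dots> = avg mu ?I (\<lambda>w. (f w)\<^sup>2) ?o * \<gamma> powr (q - 2)"
    unfolding sum_distrib_right[symmetric] by (simp only: sum_Pow_noise_sq[OF mu finite_lessThan])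
  also have "avg mu ?I (\<lambda>w. (f w)\<^sup>2) ?o = lp_pow mu ?I 2 f"
    by (simp add: lp_pow_def ex)
  finally show ?thesis by (simp add: \<rho>_def)
qed

end
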